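(* Let $G$ be a graph and let $M \in \mathcal{H}(G)$ be a Hermitian matrix with partial inertia $(k,0)$, $k > 1$. Then there exists a matrix $M^\prime \in \mathcal{H}(G)$ with partial inertia $(r,s)$ satisfying $r < k$ and $s < k$. Furthermore, if $M$ is real then $M^\prime$ can be taken to be real.
   Context: All graphs are finite, simple and undirected. For a graph $G=(V,E)$ with vertex set $V=\{1,\ldots,n\}$, $\mathcal{H}(G)$ is the set of all complex Hermitian $n\times n$ matrices $A=[a_{ij}]$ such that for $i\neq j$, $a_{ij}\neq 0$ if and only if $ij\in E$ (no condition on the diagonal entries). The partial inertia of a Hermitian matrix $A$ is the pair $(\pi(A),\nu(A))$, where $\pi(A)$ and $\nu(A)$ are the numbers of positive and of negative eigenvalues of $A$, counted with multiplicity. *)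

theory Defs
  imports
    "Graph_Theory.Pair_Digraph"
    "Jordan_Normal_Form.Schur_Decomposition"
begin

text \<open>
  Finite simple undirected graphs are the loop-free symmetric digraphs of the locale
  \<^locale>\<open>pair_graph\<close>: the edge \<open>ij\<close> is the pair of arcs \<open>(i, j)\<close>, \<open>(j, i)\<close>.
  Vertices and matrix indices both start at 0, so the vertex set of a graph on \<open>n\<close> vertices
  is \<open>{..<n}\<close>.
\<close>

definition hermitian_mat :: "complex mat \<Rightarrow> bool" where
  "hermitian_mat A \<longleftrightarrow> mat_adjoint A = A"

definition hermitian_mats_of_graph :: "nat pair_pre_digraph \<Rightarrow> complex mat set" where
  "hermitian_mats_of_graph G =
     {A \<in> carrier_mat (card (pverts G)) (card (pverts G)).
        hermitian_mat A \<and>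
        (\<forall>i\<in>pverts G. \<forall>j\<in>pverts G. i \<noteq> j \<longrightarrow> (A $$ (i, j) \<noteq> 0 \<longleftrightarrow> (i, j) \<in> parcs G))}"

text \<open>
  Multiplicities are algebraic; for Hermitian matrices they agree with the geometric ones,
  and all eigenvalues are real.
\<close>

definition num_pos_eigenvalues :: "complex mat \<Rightarrow> nat" where
  "num_pos_eigenvalues A =
     (\<Sum>x | 0 < x \<and> eigenvalue A (complex_of_real x).
        Polynomial.order (complex_of_real x) (char_poly A))"

definition num_neg_eigenvalues :: "complex mat \<Rightarrow> nat" where
  "num_neg_eigenvalues A =
     (\<Sum>x | x < 0 \<and> eigenvalue A (complex_of_real x).
        Polynomial.order (complex_of_real x) (char_poly A))"

definition partial_inertia :: "complex mat \<Rightarrow> nat \<times> nat" where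
  "partial_inertia A = (num_pos_eigenvalues A, num_neg_eigenvalues A)"

definition real_mat :: "complex mat \<Rightarrow> bool" where
  "real_mat A \<longleftrightarrow> elements_mat A \<subseteq> \<real>"

end

theory Submission
  imports Defs
begin

text \<open>
  A Hermitian matrix \<open>M\<close> with inertia \<open>(k, 0)\<close> has a Gram decomposition
  \<open>M = \<Sum>\<^sub>r w\<^sub>r w\<^sub>r\<^sup>*\<close> with \<open>k\<close> vectors \<open>w\<^sub>0, \<dots>, w\<^sub>k\<^sub>-\<^sub>1\<close>. The matrix sought is the entrywise product
  \<open>M' = M \<circ> (w\<^sub>0 w\<^sub>0\<^sup>* - w\<^sub>1 w\<^sub>1\<^sup>*)\<close>. Writing products of vectors for their entrywise products and
  \<open>[v]\<close> for \<open>v v\<^sup>*\<close>, one has \<open>[u] \<circ> [v] = [u v]\<close>, so by the identity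
  \<open>(a + b) (a - b) = a\<^sup>2 - b\<^sup>2\<close> the two cross terms \<open>[w\<^sub>0 w\<^sub>1]\<close> cancel:
  \<open>M' = [w\<^sub>0 w\<^sub>0] + \<Sum>\<^sub>r [w\<^sub>r w\<^sub>0] - [w\<^sub>1 w\<^sub>1] - \<Sum>\<^sub>r [w\<^sub>r w\<^sub>1]\<close> with \<open>r\<close> ranging over \<open>2, \<dots>, k - 1\<close>
  (\<open>gram_times_split_form\<close>). That is a sum of \<open>k - 1\<close> rank-one positive terms minus a sum of
  \<open>k - 1\<close> such terms, and a dimension count bounds both inertia indices by \<open>k - 1\<close>
  (\<open>inertia_le_of_decomposition\<close>).

  For \<open>M'\<close> to have the same zero pattern as \<open>M\<close>, the second factor must not vanish where \<open>M\<close> does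
  not. The Gram decomposition is determined only up to a unitary change of \<open>(w\<^sub>0, \<dots>, w\<^sub>k\<^sub>-\<^sub>1)\<close>,
  and a generic change achieves this. Rotations in coordinate planes suffice: along a line of
  rotation parameters each quantity to be kept nonzero is, up to a nonzero factor, a polynomial in
  one real variable, so it vanishes finitely often unless it is the zero polynomial. One first makes the
  entries of \<open>w\<^sub>0\<close> nonzero wherever possible (\<open>exists_gram_first_nonzero\<close>) and then repairs the
  positions \<open>(i, j)\<close> one at a time (\<open>exists_gram_split_form_nonzero\<close>). The latter never gets stuck,
  because the four numbers \<open>w\<^sub>r(i) cnj (w\<^sub>s(j))\<close>, \<open>r, s \<in> {0, 1}\<close>, form a matrix of rank one
  (\<open>exists_rotation_direction\<close>). If \<open>M\<close> is real, its spectral decomposition is real and real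
  rotations suffice, so that \<open>M'\<close> is real.
\<close>

section \<open>Adjoints and real matrices\<close>

lemma mat_adjoint_carrier [simp]:
  "A \<in> carrier_mat nr nc \<Longrightarrow> mat_adjoint A \<in> carrier_mat nc nr"
  by (auto simp: mat_adjoint_def mat_of_rows_def)

lemma mat_adjoint_dim [simp]:
  "dim_row (mat_adjoint A) = dim_col A" "dim_col (mat_adjoint A) = dim_row A"
  by (auto simp: mat_adjoint_def mat_of_rows_def)

lemma mat_adjoint_index:
  fixes A :: "complex mat"
  assumes "A \<in> carrier_mat nr nc" "i < nc" "j < nr"
  shows "mat_adjoint A $$ (i, j) = cnj (A $$ (j, i))"
  using assms by (auto simp: mat_adjoint_def mat_of_rows_def conjugate_complex_def)

lemma mat_adjoint_times_index:
  fixes A B :: "complex mat"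
  assumes "A \<in> carrier_mat l nr" "B \<in> carrier_mat l nc" "i < nr" "j < nc"
  shows "(mat_adjoint A * B) $$ (i, j) = (\<Sum>k<l. cnj (A $$ (k, i)) * B $$ (k, j))"
proof -
  have "(mat_adjoint A * B) $$ (i, j) = (\<Sum>k<l. mat_adjoint A $$ (i, k) * B $$ (k, j))"
    using assms mat_adjoint_carrier[OF assms(1)] by (auto simp: scalar_prod_def lessThan_atLeast0)
  then show ?thesis
    using assms by (simp add: mat_adjoint_index)
qed

lemma mat_adjoint_mult:
  fixes A B :: "complex mat"
  assumes A: "A \<in> carrier_mat nr n" and B: "B \<in> carrier_mat n nc"
  shows "mat_adjoint (A * B) = mat_adjoint B * mat_adjoint A"
proof (rule eq_matI)
  have AB: "A * B \<in> carrier_mat nr nc" using A B by simp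
  note cs = mat_adjoint_carrier[OF A] mat_adjoint_carrier[OF B] mat_adjoint_carrier[OF AB]
  show "dim_row (mat_adjoint (A * B)) = dim_row (mat_adjoint B * mat_adjoint A)"
    "dim_col (mat_adjoint (A * B)) = dim_col (mat_adjoint B * mat_adjoint A)"
    using cs by auto
  fix i j assume "i < dim_row (mat_adjoint B * mat_adjoint A)"
    and "j < dim_col (mat_adjoint B * mat_adjoint A)"
  then have i: "i < nc" and j: "j < nr" using cs by auto
  have "mat_adjoint (A * B) $$ (i, j) = cnj (\<Sum>k<n. A $$ (j, k) * B $$ (k, i))"
    using A B i j by (simp add: mat_adjoint_index[OF AB] scalar_prod_def lessThan_atLeast0)
  also have "\<dots> = (mat_adjoint B * mat_adjoint A) $$ (i, j)"
    using A B i j mat_adjoint_carrier[OF A]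
    unfolding mat_adjoint_times_index[OF B mat_adjoint_carrier[OF A] i j]
    by (simp add: mat_adjoint_index mult.commute)
  finally show "mat_adjoint (A * B) $$ (i, j) = (mat_adjoint B * mat_adjoint A) $$ (i, j)" .
qed

lemma mat_adjoint_adjoint:
  fixes A :: "complex mat"
  assumes "A \<in> carrier_mat nr nc"
  shows "mat_adjoint (mat_adjoint A) = A"
  using assms mat_adjoint_index[OF mat_adjoint_carrier[OF assms]]
  by (intro eq_matI) (auto simp: mat_adjoint_index)

lemma hermitian_mat_iff:
  assumes "A \<in> carrier_mat n n"
  shows "hermitian_mat A \<longleftrightarrow> (\<forall>i<n. \<forall>j<n. A $$ (i, j) = cnj (A $$ (j, i)))"
proof
  assume "hermitian_mat A"
  then show "\<forall>i<n. \<forall>j<n. A $$ (i, j) = cnj (A $$ (j, i))"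
    using assms by (metis hermitian_mat_def mat_adjoint_index)
next
  assume *: "\<forall>i<n. \<forall>j<n. A $$ (i, j) = cnj (A $$ (j, i))"
  have "mat_adjoint A $$ (i, j) = A $$ (i, j)" if "i < n" "j < n" for i j
    using *[rule_format, OF that] by (simp only: mat_adjoint_index[OF assms that])
  then show "hermitian_mat A"
    unfolding hermitian_mat_def using assms by (intro eq_matI) auto
qed

lemma real_mat_iff:
  assumes "A \<in> carrier_mat nr nc"
  shows "real_mat A \<longleftrightarrow> (\<forall>i<nr. \<forall>j<nc. A $$ (i, j) \<in> \<real>)"
  unfolding real_mat_def using assms by auto

lemma real_mat_mult:
  assumes "A \<in> carrier_mat nr n" "B \<in> carrier_mat n nc" "real_mat A" "real_mat B"
  shows "real_mat (A * B)"
  using assms real_mat_iff[OF assms(1)] real_mat_iff[OF assms(2)]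
  by (subst real_mat_iff[of _ nr nc]) (auto simp: scalar_prod_def intro!: sum_in_Reals Reals_mult)

lemma real_mat_adjoint:
  assumes "A \<in> carrier_mat nr nc" "real_mat A"
  shows "real_mat (mat_adjoint A)"
  using assms real_mat_iff[OF assms(1)]
  by (subst real_mat_iff[OF mat_adjoint_carrier[OF assms(1)]]) (auto simp: mat_adjoint_index)

section \<open>Spectral theorem for Hermitian matrices\<close>

lemma sum_delta_mult:
  fixes f :: "nat \<Rightarrow> complex"
  assumes "i < n"
  shows "(\<Sum>l<n. (if l = i then 1 else 0) * f l) = f i" "(\<Sum>l<n. f l * (if l = i then 1 else 0)) = f i"
  using assms by (auto simp: if_distrib if_distribR cong: if_cong)

text \<open>
  The matrix is a Householder reflection \<open>I - 2 w w\<^sup>* / |w|\<^sup>2\<close> with \<open>w = z - e\<^sub>0\<close>, where \<open>z\<close> is \<open>v\<close>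
  scaled to length one. It maps \<open>e\<^sub>0\<close> to \<open>z\<close> provided that \<open>z\<^sub>0\<close> is real, and the phase is chosen
  such that \<open>z\<^sub>0 \<le> 0\<close>, which also keeps \<open>w\<close> away from \<open>0\<close>. Unlike a completion to an orthogonal basis
  this construction makes it obvious that a real \<open>v\<close> gives a real matrix.
\<close>

lemma exists_unitary_first_column:
  fixes v :: "nat \<Rightarrow> complex"
  assumes "0 < n" and "\<exists>i<n. v i \<noteq> 0"
  shows "\<exists>W \<in> carrier_mat n n. mat_adjoint W * W = 1\<^sub>m n \<and> (\<exists>c. \<forall>i<n. W $$ (i, 0) = c * v i) \<and>
    ((\<forall>i<n. v i \<in> \<real>) \<longrightarrow> real_mat W)"
proof -
  define N where "N = (\<Sum>i<n. (cmod (v i))\<^sup>2)"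
  have "N > 0"
  proof -
    obtain i where "i < n" "v i \<noteq> 0" using assms by blast
    then show ?thesis unfolding N_def by (intro sum_pos2[of _ i]) auto
  qed
  define u where "u = (if v 0 = 0 then 1 else - cnj (v 0) / cmod (v 0))"
  have u1: "u * cnj u = 1"
    proof (cases "v 0 = 0")
    case False
    have "u * cnj u = (v 0 * cnj (v 0)) / (complex_of_real (cmod (v 0)))\<^sup>2"
      using False by (simp add: u_def power2_eq_square)
    then show ?thesis using False by (simp add: complex_norm_square[symmetric])
  qed (simp add: u_def)
  define z where "z i = u * v i / sqrt N" for i
  define a where "a = cmod (v 0) / sqrt N"
  have a0: "a \<ge> 0" using \<open>N > 0\<close> by (simp add: a_def)
  have z0: "z 0 = - complex_of_real a"
    unfolding z_def u_def a_def
    using complex_norm_square[of "v 0"]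
    by (auto simp: power2_eq_square mult.commute divide_simps)
  have zz: "(\<Sum>i<n. z i * cnj (z i)) = 1"
  proof -
    have "z i * cnj (z i) = complex_of_real ((cmod (v i))\<^sup>2 / N)" for i
    proof -
      have "z i * cnj (z i) = (u * cnj u) * (v i * cnj (v i)) / complex_of_real (sqrt N * sqrt N)"
        by (simp add: z_def mult_ac del: real_sqrt_mult_self)
      also have "\<dots> = complex_of_real ((cmod (v i))\<^sup>2 / N)"
        using \<open>N > 0\<close> unfolding u1 by (simp add: complex_norm_square[symmetric])
      finally show ?thesis .
    qed
    then have "(\<Sum>i<n. z i * cnj (z i)) = complex_of_real (\<Sum>i<n. (cmod (v i))\<^sup>2 / N)" by simp
    also have "(\<Sum>i<n. (cmod (v i))\<^sup>2 / N) = 1"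
      using \<open>N > 0\<close> by (simp add: N_def sum_divide_distrib[symmetric])
    finally show ?thesis by simp
  qed
  define D where "D i j = (if i = j then 1 else 0 :: complex)" for i j :: nat
  define w where "w i = z i - D i 0" for i
  define b where "b = 1 + complex_of_real a"
  have b0: "b \<noteq> 0"
    using a0 by (auto simp: b_def complex_eq_iff)
  have ww: "(\<Sum>i<n. cnj (w i) * w i) = 2 * b"
  proof -
    have "cnj (w i) * w i = z i * cnj (z i) - D i 0 * z i - D i 0 * cnj (z i) + D i 0 * 1" for i
      by (simp add: w_def D_def algebra_simps)
    then have "(\<Sum>i<n. cnj (w i) * w i) = (\<Sum>i<n. z i * cnj (z i)) - (\<Sum>i<n. D i 0 * z i)
        - (\<Sum>i<n. D i 0 * cnj (z i)) + (\<Sum>i<n. D i 0 * 1)"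
      by (simp only: sum.distrib sum_subtractf)
    also have "\<dots> = 1 - z 0 - cnj (z 0) + 1"
      using assms(1) unfolding D_def by (simp only: sum_delta_mult zz)
    finally show ?thesis by (simp add: z0 b_def)
  qed
  \<comment> \<open>since \<open>|w|\<^sup>2 = 2 b\<close>, this is the reflection \<open>I - 2 w w\<^sup>* / |w|\<^sup>2\<close>\<close>
  define W where "W = mat n n (\<lambda>(i, j). D i j - w i * cnj (w j) / b)"
  have W: "W \<in> carrier_mat n n" by (simp add: W_def)
  have "mat_adjoint W * W = 1\<^sub>m n"
  proof (rule eq_matI)
    fix i j assume "i < dim_row (1\<^sub>m n :: complex mat)" "j < dim_col (1\<^sub>m n :: complex mat)"
    then have ij: "i < n" "j < n" by auto
    have cb: "cnj b = b" by (simp add: b_def)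
    have "(mat_adjoint W * W) $$ (i, j) = (\<Sum>l<n. cnj (W $$ (l, i)) * W $$ (l, j))"
      using ij by (rule mat_adjoint_times_index[OF W W])
    also have "\<dots> = (\<Sum>l<n. D l i * D l j - D l i * w l * (cnj (w j) / b)
        - w i / b * (cnj (w l) * D l j) + w i * cnj (w j) / (b * b) * (cnj (w l) * w l))"
      using ij b0 by (intro sum.cong) (auto simp: W_def D_def cb field_simps)
    also have "\<dots> = (\<Sum>l<n. D l i * D l j) - (\<Sum>l<n. D l i * w l) * (cnj (w j) / b)
        - w i / b * (\<Sum>l<n. cnj (w l) * D l j) + w i * cnj (w j) / (b * b) * (\<Sum>l<n. cnj (w l) * w l)"
      by (simp only: sum.distrib sum_subtractf sum_distrib_left sum_distrib_right)
    also have "\<dots> = D i j - w i * (cnj (w j) / b) - w i / b * cnj (w j) + w i * cnj (w j) / (b * b) * (2 * b)"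
      unfolding ww using ij unfolding D_def by (simp only: sum_delta_mult)
    also have "\<dots> = D i j" using b0 by (simp add: field_simps)
    finally show "(mat_adjoint W * W) $$ (i, j) = 1\<^sub>m n $$ (i, j)" using ij by (simp add: D_def)
  qed (use W mat_adjoint_carrier[OF W] in auto)
  moreover have "W $$ (i, 0) = u / sqrt N * v i" if "i < n" for i
  proof -
    have "cnj (w 0) = - b" by (simp add: w_def z0 D_def b_def)
    then have "W $$ (i, 0) = D i 0 + w i" using that assms(1) b0 by (simp add: W_def)
    then show ?thesis by (simp add: w_def z_def)
  qed
  moreover have "real_mat W" if r: "\<forall>i<n. v i \<in> \<real>"
  proof -
    have "u \<in> \<real>" using r assms(1) by (auto simp: u_def intro!: Reals_divide Reals_minus)
    then have "z i \<in> \<real>" if "i < n" for i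
      using r that by (auto simp: z_def intro!: Reals_divide Reals_mult)
    then have "w i \<in> \<real>" if "i < n" for i
      using that by (auto simp: w_def D_def intro!: Reals_diff)
    then show ?thesis
      unfolding real_mat_iff[OF W]
      by (auto simp: W_def D_def b_def intro!: Reals_diff Reals_divide Reals_mult Reals_add)
  qed
  ultimately show ?thesis using W by blast
qed

text \<open>
  The eigenvalue is real because \<open>x\<^sup>* A x\<close> is. For real \<open>A\<close>, the eigenspace is then closed under complex
  conjugation, so it contains the real vectors \<open>s x + cnj (s x)\<close>; these are not all \<open>0\<close>.
\<close>

lemma hermitian_eigenvector:
  assumes A: "A \<in> carrier_mat n n" and h: "hermitian_mat A" and n: "0 < n"
  shows "\<exists>(e :: real) v. (\<exists>i<n. v i \<noteq> 0) \<and>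
    (\<forall>i<n. (\<Sum>j<n. A $$ (i, j) * v j) = complex_of_real e * v i) \<and>
    (real_mat A \<longrightarrow> (\<forall>i<n. v i \<in> \<real>))"
proof -
  have "degree (char_poly A) = n" using degree_monic_char_poly[OF A] by simp
  then obtain c where "poly (char_poly A) c = 0"
    using n fundamental_theorem_of_algebra[of "char_poly A"] by (metis constant_degree gr_implies_not_zero)
  then obtain x where "eigenvector A x c"
    using eigenvalue_root_char_poly[OF A] unfolding eigenvalue_def by blast
  then have x: "x \<in> carrier_vec n" "x \<noteq> 0\<^sub>v n" "A *\<^sub>v x = c \<cdot>\<^sub>v x"
    using A unfolding eigenvector_def by auto
  have ev: "(\<Sum>j<n. A $$ (i, j) * x $ j) = c * x $ i" if "i < n" for i
    using arg_cong[OF x(3), of "\<lambda>y. y $ i"] that A x(1)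
    by (simp add: scalar_prod_def lessThan_atLeast0)
  have nz: "\<exists>i<n. x $ i \<noteq> 0"
    using x(1,2) by (metis carrier_vecD eq_vecI index_zero_vec)
  define S where "S = (\<Sum>i<n. (cmod (x $ i))\<^sup>2)"
  have "S > 0"
    using nz unfolding S_def by (auto intro!: sum_pos2)
  define Q where "Q = (\<Sum>i<n. \<Sum>j<n. cnj (x $ i) * A $$ (i, j) * x $ j)"
  have "Q = c * complex_of_real S"
  proof -
    have "Q = (\<Sum>i<n. cnj (x $ i) * (\<Sum>j<n. A $$ (i, j) * x $ j))"
      by (simp add: Q_def sum_distrib_left mult.assoc)
    also have "\<dots> = (\<Sum>i<n. c * (x $ i * cnj (x $ i)))"
      by (intro sum.cong refl) (simp add: ev)
    finally show ?thesis by (simp add: S_def sum_distrib_left complex_norm_square[symmetric])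
  qed
  moreover have "cnj Q = Q"
  proof -
    have "cnj Q = (\<Sum>i<n. \<Sum>j<n. x $ i * A $$ (j, i) * cnj (x $ j))"
      unfolding Q_def cnj_sum complex_cnj_mult complex_cnj_cnj
      using h[unfolded hermitian_mat_iff[OF A], rule_format, symmetric] by (intro sum.cong) auto
    also have "\<dots> = Q"
      unfolding Q_def by (subst sum.swap) (simp add: mult_ac)
    finally show ?thesis .
  qed
  ultimately have "cnj c = c" using \<open>S > 0\<close> by simp
  then obtain e where c: "c = complex_of_real e" by (metis Reals_cases Reals_cnj_iff)
  show ?thesis
  proof (cases "real_mat A")
    case False
    then show ?thesis using nz ev c by (intro exI[of _ e] exI[of _ "\<lambda>i. x $ i"]) simp
  next
    case True
    then have Ar: "cnj (A $$ (i, j)) = A $$ (i, j)" if "i < n" "j < n" for i j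
      using real_mat_iff[OF A] that Reals_cnj_iff by blast
    obtain s where s: "\<exists>i<n. s * x $ i + cnj (s * x $ i) \<noteq> 0"
    proof -
      obtain i where i: "i < n" "x $ i \<noteq> 0" using nz by blast
      have "cnj (x $ i) * x $ i + cnj (cnj (x $ i) * x $ i) = complex_of_real (2 * (cmod (x $ i))\<^sup>2)"
        by (simp add: complex_norm_square[symmetric] mult.commute)
      moreover have "complex_of_real (2 * (cmod (x $ i))\<^sup>2) \<noteq> 0" using i(2) by simp
      ultimately have "cnj (x $ i) * x $ i + cnj (cnj (x $ i) * x $ i) \<noteq> 0" by metis
      with i(1) show thesis by (intro that[of "cnj (x $ i)"] exI[of _ i] conjI)
    qed
    define v where "v i = s * x $ i + cnj (s * x $ i)" for i
    have "(\<Sum>j<n. A $$ (i, j) * v j) = complex_of_real e * v i" if i: "i < n" for i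
    proof -
      let ?y = "\<Sum>j<n. A $$ (i, j) * x $ j"
      have "(\<Sum>j<n. A $$ (i, j) * v j)
          = (\<Sum>j<n. s * (A $$ (i, j) * x $ j) + cnj s * cnj (A $$ (i, j) * x $ j))"
        using Ar[OF i] by (intro sum.cong) (auto simp: v_def algebra_simps)
      also have "\<dots> = s * ?y + cnj s * cnj ?y"
        by (simp only: sum.distrib sum_distrib_left cnj_sum)
      finally have "(\<Sum>j<n. A $$ (i, j) * v j) = s * ?y + cnj s * cnj ?y" .
      then show ?thesis unfolding ev[OF i] by (simp add: c v_def algebra_simps)
    qed
    moreover have "v i \<in> \<real>" for i
      unfolding Reals_cnj_iff v_def by simp
    ultimately show ?thesis
      using s by (intro exI[of _ e] exI[of _ v]) (simp add: v_def)
  qed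
qed

lemma four_block_diag_mult:
  fixes A A' D D' :: "complex mat"
  assumes "A \<in> carrier_mat l l" "A' \<in> carrier_mat l l" "D \<in> carrier_mat m m" "D' \<in> carrier_mat m m"
  shows "four_block_mat A (0\<^sub>m l m) (0\<^sub>m m l) D * four_block_mat A' (0\<^sub>m l m) (0\<^sub>m m l) D'
    = four_block_mat (A * A') (0\<^sub>m l m) (0\<^sub>m m l) (D * D')"
  using assms
  by (subst mult_four_block_mat[of _ l l _ m _ m _ _ l _ m])
    (auto simp: left_mult_zero_mat[OF assms(4)] right_mult_zero_mat[OF assms(3)]
      left_mult_zero_mat[OF assms(2)] right_mult_zero_mat[OF assms(1)])

text \<open>
  The spectral theorem, with a real eigenbasis for a real matrix. The induction deflates: conjugating by
  a unitary matrix whose first column is an eigenvector splits off a \<open>1 \<times> 1\<close> block, because the zeros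
  below the first diagonal entry are mirrored in the first row.
\<close>

theorem hermitian_diagonalization:
  assumes "A \<in> carrier_mat n n" and "hermitian_mat A"
  shows "\<exists>U \<in> carrier_mat n n. \<exists>d :: nat \<Rightarrow> real. mat_adjoint U * U = 1\<^sub>m n \<and>
    A = U * mat_diag n (\<lambda>i. complex_of_real (d i)) * mat_adjoint U \<and> (real_mat A \<longrightarrow> real_mat U)"
  using assms
proof (induction n arbitrary: A)
  case 0
  then show ?case
    by (intro bexI[of _ "1\<^sub>m 0"] exI[of _ "\<lambda>_. 0"]) (auto simp: real_mat_def)
next
  case (Suc m)
  let ?n = "Suc m"
  note A = Suc.prems(1) and h = Suc.prems(2)
  obtain e v where ev_v: "(\<exists>i<?n. v i \<noteq> 0) \<and>
      (\<forall>i<?n. (\<Sum>j<?n. A $$ (i, j) * v j) = complex_of_real e * v i) \<and>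
      (real_mat A \<longrightarrow> (\<forall>i<?n. v i \<in> \<real>))"
    using hermitian_eigenvector[OF A h zero_less_Suc] by (elim exE) rule
  then have v: "\<exists>i<?n. v i \<noteq> 0" and vr: "real_mat A \<longrightarrow> (\<forall>i<?n. v i \<in> \<real>)"
    and ev: "\<And>i. i < ?n \<Longrightarrow> (\<Sum>j<?n. A $$ (i, j) * v j) = complex_of_real e * v i"
    by (blast, blast, blast)
  obtain W where W: "W \<in> carrier_mat ?n ?n" and W_props: "mat_adjoint W * W = 1\<^sub>m ?n \<and>
      (\<exists>c. \<forall>i<?n. W $$ (i, 0) = c * v i) \<and> ((\<forall>i<?n. v i \<in> \<real>) \<longrightarrow> real_mat W)"
    using exists_unitary_first_column[OF zero_less_Suc v] by (rule bexE)
  from W_props obtain c where W0: "\<And>i. i < ?n \<Longrightarrow> W $$ (i, 0) = c * v i" by metis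
  from W_props have WW: "mat_adjoint W * W = 1\<^sub>m ?n" by (rule conjunct1)
  have Wr: "real_mat W" if "real_mat A" using W_props vr that by (elim conjE) simp
  let ?W = "mat_adjoint W"
  have W': "?W \<in> carrier_mat ?n ?n" using W by simp
  have WW': "W * ?W = 1\<^sub>m ?n" using mat_mult_left_right_inverse[OF W' W WW] .
  define B where "B = ?W * (A * W)"
  have AW: "A * W \<in> carrier_mat ?n ?n" using A W by simp
  have B: "B \<in> carrier_mat ?n ?n" unfolding B_def using AW W' by (rule mult_carrier_mat[rotated])
  have "mat_adjoint B = B"
    using h unfolding B_def mat_adjoint_mult[OF W' AW] mat_adjoint_mult[OF A W] hermitian_mat_def
    using A W W' by (simp add: mat_adjoint_adjoint[OF W] assoc_mult_mat[of _ ?n ?n _ ?n _ ?n])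
  then have hB: "B $$ (i, j) = cnj (B $$ (j, i))" if "i < ?n" "j < ?n" for i j
    using hermitian_mat_iff[OF B] that unfolding hermitian_mat_def by blast
  have B0: "B $$ (i, 0) = (if i = 0 then complex_of_real e else 0)" if i: "i < ?n" for i
  proof -
    have "(A * W) $$ (l, 0) = complex_of_real e * W $$ (l, 0)" if "l < ?n" for l
    proof -
      have "(A * W) $$ (l, 0) = (\<Sum>j<?n. A $$ (l, j) * W $$ (j, 0))"
        using A W that by (simp add: scalar_prod_def lessThan_atLeast0 del: sum.lessThan_Suc sum.op_ivl_Suc)
      also have "\<dots> = c * (\<Sum>j<?n. A $$ (l, j) * v j)"
        unfolding sum_distrib_left by (intro sum.cong) (auto simp: W0)
      finally show ?thesis unfolding ev[OF that] W0[OF that] by (simp add: mult_ac)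
    qed
    then have "B $$ (i, 0) = (\<Sum>l<?n. cnj (W $$ (l, i)) * (complex_of_real e * W $$ (l, 0)))"
      unfolding B_def using mat_adjoint_times_index[OF W AW i, of 0] by simp
    also have "\<dots> = complex_of_real e * (?W * W) $$ (i, 0)"
      unfolding mat_adjoint_times_index[OF W W i zero_less_Suc] sum_distrib_left
      by (intro sum.cong) auto
    finally show ?thesis using i unfolding WW by simp
  qed
  define A3 where "A3 = mat m m (\<lambda>(i, j). B $$ (Suc i, Suc j))"
  have A3: "A3 \<in> carrier_mat m m" by (simp add: A3_def)
  let ?E = "mat 1 1 (\<lambda>_. complex_of_real e)"
  have Bblock: "B = four_block_mat ?E (0\<^sub>m 1 m) (0\<^sub>m m 1) A3"
  proof (rule eq_matI)
    fix i j assume "i < dim_row (four_block_mat ?E (0\<^sub>m 1 m) (0\<^sub>m m 1) A3)"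
      "j < dim_col (four_block_mat ?E (0\<^sub>m 1 m) (0\<^sub>m m 1) A3)"
    then have ij: "i < ?n" "j < ?n" by (auto simp: A3_def)
    show "B $$ (i, j) = four_block_mat ?E (0\<^sub>m 1 m) (0\<^sub>m m 1) A3 $$ (i, j)"
      using ij B0[of i] B0[of j] hB[of 0 j] by (cases i; cases j) (auto simp: A3_def)
  qed (use B in \<open>auto simp: A3_def\<close>)
  have "hermitian_mat A3"
    unfolding hermitian_mat_iff[OF A3]
  proof (intro allI impI)
    fix i j assume "i < m" "j < m"
    then show "A3 $$ (i, j) = cnj (A3 $$ (j, i))"
      using hB[of "Suc i" "Suc j"] by (simp add: A3_def)
  qed
  from Suc.IH[OF A3 this] obtain U3 where U3: "U3 \<in> carrier_mat m m" and U3_props: "\<exists>d :: nat \<Rightarrow> real.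
      mat_adjoint U3 * U3 = 1\<^sub>m m \<and>
      A3 = U3 * mat_diag m (\<lambda>i. complex_of_real (d i)) * mat_adjoint U3 \<and> (real_mat A3 \<longrightarrow> real_mat U3)"
    by (rule bexE)
  from U3_props obtain d3 where UU3: "mat_adjoint U3 * U3 = 1\<^sub>m m"
    and A3d: "A3 = U3 * mat_diag m (\<lambda>i. complex_of_real (d3 i)) * mat_adjoint U3"
    and r3: "real_mat A3 \<longrightarrow> real_mat U3" by metis
  let ?D3 = "mat_diag m (\<lambda>i. complex_of_real (d3 i))"
  have U3': "mat_adjoint U3 \<in> carrier_mat m m" using U3 by simp
  define V where "V = four_block_mat (1\<^sub>m 1) (0\<^sub>m 1 m) (0\<^sub>m m 1) U3"
  have V: "V \<in> carrier_mat ?n ?n" using U3 by (auto simp: V_def)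
  have V': "mat_adjoint V = four_block_mat (1\<^sub>m 1) (0\<^sub>m 1 m) (0\<^sub>m m 1) (mat_adjoint U3)"
  proof (rule eq_matI)
    fix i j assume "i < dim_row (four_block_mat (1\<^sub>m 1) (0\<^sub>m 1 m) (0\<^sub>m m 1) (mat_adjoint U3))"
      "j < dim_col (four_block_mat (1\<^sub>m 1) (0\<^sub>m 1 m) (0\<^sub>m m 1) (mat_adjoint U3))"
    then have ij: "i < ?n" "j < ?n" using U3' by auto
    then show "mat_adjoint V $$ (i, j)
        = four_block_mat (1\<^sub>m 1) (0\<^sub>m 1 m) (0\<^sub>m m 1) (mat_adjoint U3) $$ (i, j)"
      unfolding mat_adjoint_index[OF V ij] using U3 U3'
      by (cases i; cases j) (auto simp: V_def mat_adjoint_index)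
  qed (use V U3 in auto)
  define d where "d = case_nat e d3"
  let ?D = "mat_diag ?n (\<lambda>i. complex_of_real (d i))"
  have D: "?D = four_block_mat ?E (0\<^sub>m 1 m) (0\<^sub>m m 1) ?D3"
    by (rule eq_matI) (auto simp: mat_diag_def d_def split: nat.split)
  have VV: "mat_adjoint V * V = 1\<^sub>m ?n"
    unfolding V' unfolding V_def
    by (subst four_block_diag_mult) (use U3 U3' UU3 in auto)
  have VD: "V * ?D = four_block_mat ?E (0\<^sub>m 1 m) (0\<^sub>m m 1) (U3 * ?D3)"
    unfolding D unfolding V_def by (subst four_block_diag_mult) (use U3 in auto)
  have BV: "B = V * ?D * mat_adjoint V"
    unfolding VD Bblock V' A3d
    by (subst four_block_diag_mult) (use U3 U3' in \<open>auto intro: mult_carrier_mat\<close>)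
  have Ds: "?D \<in> carrier_mat ?n ?n" by simp
  define U where "U = W * V"
  have U: "U \<in> carrier_mat ?n ?n" using W V by (simp add: U_def)
  have U': "mat_adjoint U = mat_adjoint V * ?W" unfolding U_def by (rule mat_adjoint_mult[OF W V])
  have Vc': "mat_adjoint V \<in> carrier_mat ?n ?n" using V by simp
  note assoc = assoc_mult_mat[of _ ?n ?n _ ?n _ ?n] mult_carrier_mat[of _ ?n ?n _ ?n]
  have "mat_adjoint U * U = mat_adjoint V * ((?W * W) * V)"
    unfolding U' unfolding U_def using W V W' Vc' by (simp add: assoc)
  then have UU: "mat_adjoint U * U = 1\<^sub>m ?n" unfolding WW using V VV by simp
  have "A = (W * ?W) * A * (W * ?W)" unfolding WW' using A by simp
  also have "\<dots> = W * B * ?W" unfolding B_def using A W W' by (simp add: assoc)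
  also have "\<dots> = U * ?D * mat_adjoint U"
    unfolding BV U' unfolding U_def using W V W' Vc' Ds by (simp add: assoc)
  finally have AU: "A = U * ?D * mat_adjoint U" .
  have "real_mat U" if r: "real_mat A"
  proof -
    have "real_mat B"
      unfolding B_def using r Wr[OF r] A W W'
      by (intro real_mat_mult[OF W'] real_mat_mult[OF A] real_mat_adjoint[OF W]) auto
    then have "real_mat A3" unfolding real_mat_iff[OF B] real_mat_iff[OF A3] by (simp add: A3_def)
    from r3[rule_format, OF this] have "real_mat V"
      unfolding real_mat_iff[OF U3] real_mat_iff[OF V] using U3 by (auto simp: V_def)
    then show ?thesis unfolding U_def using real_mat_mult[OF W V] Wr[OF r] by blast
  qed
  with U UU AU show ?case by blast
qed

section \<open>Inertia and sums of rank-one forms\<close>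

lemma order_prod_linear:
  fixes d :: "nat \<Rightarrow> complex"
  shows "Polynomial.order x (\<Prod>i<n. [:- d i, 1:]) = card {i. i < n \<and> d i = x}"
proof (induction n)
  case (Suc n)
  have "{i. i < Suc n \<and> d i = x} = (if d n = x then insert n {i. i < n \<and> d i = x} else {i. i < n \<and> d i = x})"
    by (auto simp: less_Suc_eq)
  moreover have "(\<Prod>i<n. [:- d i, 1:]) * [:- d n, 1:] \<noteq> 0" unfolding mult_eq_0_iff by simp
  note order_mult[OF this, of x]
  moreover have "Polynomial.order x [:- d n, 1:] = (if d n = x then 1 else 0)"
    using order_linear_power'[of x "- d n" 1] by (auto simp: order_0I)
  ultimately show ?case using Suc.IH by (simp del: mult_pCons_right)
qed simp

text \<open>
  With \<open>P\<close> being positivity or negativity, the left-hand side is one of the two inertia indices; it becomes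
  the number of corresponding entries of the spectral diagonal.
\<close>

lemma eigenvalue_count_diagonalized:
  assumes U: "U \<in> carrier_mat n n" and UU: "mat_adjoint U * U = 1\<^sub>m n"
    and A: "A = U * mat_diag n (\<lambda>i. complex_of_real (d i)) * mat_adjoint U"
  shows "(\<Sum>x | P x \<and> eigenvalue A (complex_of_real x).
      Polynomial.order (complex_of_real x) (char_poly A)) = card {i. i < n \<and> P (d i)}"
proof -
  let ?D = "mat_diag n (\<lambda>i. complex_of_real (d i))"
  have U': "mat_adjoint U \<in> carrier_mat n n" using U by simp
  have Ac: "A \<in> carrier_mat n n" unfolding A using U U' by (intro mult_carrier_mat) auto
  have "similar_mat_wit A ?D U (mat_adjoint U)"
    using mat_mult_left_right_inverse[OF U' U UU] UU A Ac U U' by (intro similar_mat_witI[of _ _ n]) auto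
  then have "char_poly A = char_poly ?D"
    by (intro char_poly_similar) (auto simp: similar_mat_def)
  also have "\<dots> = (\<Prod>a\<leftarrow>diag_mat ?D. [:- a, 1:])"
    by (rule char_poly_upper_triangular[of _ n]) (auto simp: mat_diag_def)
  also have "diag_mat ?D = map (\<lambda>i. complex_of_real (d i)) [0..<n]"
    by (auto simp: diag_mat_def mat_diag_def)
  also have "(\<Prod>a\<leftarrow>map (\<lambda>i. complex_of_real (d i)) [0..<n]. [:- a, 1:])
      = (\<Prod>i<n. [:- complex_of_real (d i), 1:])"
    by (simp add: prod.distinct_set_conv_list[symmetric] lessThan_atLeast0 comp_def)
  finally have cp: "char_poly A = (\<Prod>i<n. [:- complex_of_real (d i), 1:])" .
  have ord: "Polynomial.order (complex_of_real x) (char_poly A) = card {i. i < n \<and> d i = x}" for x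
    unfolding cp order_prod_linear by (simp only: of_real_eq_iff)
  have "eigenvalue A (complex_of_real x) \<longleftrightarrow> x \<in> d ` {..<n}" for x
    unfolding eigenvalue_root_char_poly[OF Ac] cp poly_prod by auto
  then have "{x. P x \<and> eigenvalue A (complex_of_real x)} = d ` {i. i < n \<and> P (d i)}" by auto
  moreover have "card {i. i < n \<and> P (d i)} = (\<Sum>x\<in>d ` {i. i < n \<and> P (d i)}. card {i. i < n \<and> d i = x})"
  proof -
    have "card {i. i < n \<and> P (d i)}
        = (\<Sum>x\<in>d ` {i. i < n \<and> P (d i)}. card {i \<in> {i. i < n \<and> P (d i)}. d i = x})"
      using sum.image_gen[of "{i. i < n \<and> P (d i)}" "\<lambda>_. 1 :: nat" d] by simp
    also have "\<dots> = (\<Sum>x\<in>d ` {i. i < n \<and> P (d i)}. card {i. i < n \<and> d i = x})"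
      by (intro sum.cong arg_cong[of _ _ card]) auto
    finally show ?thesis .
  qed
  ultimately show ?thesis by (simp add: ord)
qed

lemma spectral_entries:
  assumes U: "U \<in> carrier_mat n n"
    and A: "A = U * mat_diag n (\<lambda>i. complex_of_real (d i)) * mat_adjoint U"
    and ij: "i < n" "j < n"
  shows "A $$ (i, j) = (\<Sum>m<n. complex_of_real (d m) * (U $$ (i, m) * cnj (U $$ (j, m))))"
proof -
  have "A $$ (i, j) = (\<Sum>m<n. U $$ (i, m) * complex_of_real (d m) * mat_adjoint U $$ (m, j))"
    unfolding A mat_diag_mult_right[OF U] using U ij by (simp add: scalar_prod_def lessThan_atLeast0)
  then show ?thesis using ij by (simp add: mat_adjoint_index[OF U] mult_ac)
qed

text \<open>
  The \<open>p\<close> equations are padded by zero rows to a square system, whose determinant vanishes.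
\<close>

lemma underdetermined_system:
  fixes a :: "nat \<Rightarrow> nat \<Rightarrow> complex"
  assumes "finite S" "p < card S"
  shows "\<exists>c. (\<exists>m\<in>S. c m \<noteq> 0) \<and> (\<forall>r<p. (\<Sum>m\<in>S. a r m * c m) = 0)"
proof -
  let ?s = "card S"
  obtain h where h: "bij_betw h {..<?s} S"
    using ex_bij_betw_nat_finite[OF assms(1)] unfolding lessThan_atLeast0 by blast
  \<comment> \<open>row \<open>p\<close> is singled out only to present it as a zero row syntactically\<close>
  define K where "K = mat\<^sub>r ?s ?s
    (\<lambda>r. if r = p then 0\<^sub>v ?s else vec ?s (\<lambda>m. if r < p then a r (h m) else 0))"
  have K: "K \<in> carrier_mat ?s ?s" by (simp add: K_def)
  have "det K = 0" unfolding K_def using assms(2) by (intro det_row_0) auto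
  then obtain v where v: "v \<in> carrier_vec ?s" "v \<noteq> 0\<^sub>v ?s" "K *\<^sub>v v = 0\<^sub>v ?s"
    using det_0_iff_vec_prod_zero_field[OF K] by blast
  define c where "c m = v $ (inv_into {..<?s} h m)" for m
  have ch: "c (h m) = v $ m" if "m < ?s" for m
    using bij_betw_inv_into_left[OF h] that by (simp add: c_def)
  obtain m where m: "m < ?s" "v $ m \<noteq> 0"
    using v(1,2) by (metis carrier_vecD eq_vecI index_zero_vec)
  have "h m \<in> S" using h m(1) by (auto simp: bij_betw_def)
  moreover have "(\<Sum>m\<in>S. a r m * c m) = 0" if "r < p" for r
  proof -
    have "(\<Sum>m\<in>S. a r m * c m) = (\<Sum>m<?s. a r (h m) * v $ m)"
      by (subst sum.reindex_bij_betw[OF h, symmetric]) (simp add: ch)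
    also have "\<dots> = (K *\<^sub>v v) $ r"
      using that assms(2) v(1) by (auto simp: K_def scalar_prod_def lessThan_atLeast0)
    finally show ?thesis using v(3) that assms(2) by simp
  qed
  ultimately show ?thesis using m(2) ch[OF m(1)] by (intro exI[of _ c] conjI bexI[of _ "h m"]) simp_all
qed

lemma sum_rank_one_form:
  fixes x f :: "nat \<Rightarrow> complex"
  shows "(\<Sum>i<n. \<Sum>j<n. cnj (x i) * (f i * cnj (f j)) * x j)
    = complex_of_real ((cmod (\<Sum>i<n. cnj (f i) * x i))\<^sup>2)"
proof -
  let ?y = "\<Sum>i<n. cnj (f i) * x i"
  have "(\<Sum>i<n. \<Sum>j<n. cnj (x i) * (f i * cnj (f j)) * x j) = cnj ?y * ?y"
    by (simp add: sum_product mult_ac)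
  also have "\<dots> = complex_of_real ((cmod ?y)\<^sup>2)"
    unfolding complex_norm_square by (rule mult.commute)
  finally show ?thesis .
qed

lemma hermitian_form_sum:
  fixes x :: "nat \<Rightarrow> complex" and f :: "nat \<Rightarrow> nat \<Rightarrow> complex" and c :: "nat \<Rightarrow> real"
  shows "(\<Sum>i<n. \<Sum>j<n. cnj (x i) * (\<Sum>r<p. complex_of_real (c r) * (f r i * cnj (f r j))) * x j)
    = complex_of_real (\<Sum>r<p. c r * (cmod (\<Sum>i<n. cnj (f r i) * x i))\<^sup>2)"
proof -
  have "(\<Sum>i<n. \<Sum>j<n. cnj (x i) * (\<Sum>r<p. complex_of_real (c r) * (f r i * cnj (f r j))) * x j)
      = (\<Sum>i<n. \<Sum>r<p. \<Sum>j<n. complex_of_real (c r) * (cnj (x i) * (f r i * cnj (f r j)) * x j))"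
    by (subst sum.swap) (simp add: sum_distrib_left sum_distrib_right mult_ac)
  also have "\<dots> = (\<Sum>r<p. \<Sum>i<n. \<Sum>j<n. complex_of_real (c r) * (cnj (x i) * (f r i * cnj (f r j)) * x j))"
    by (rule sum.swap)
  also have "\<dots> = (\<Sum>r<p. complex_of_real (c r) * (\<Sum>i<n. \<Sum>j<n. cnj (x i) * (f r i * cnj (f r j)) * x j))"
    by (simp only: sum_distrib_left)
  finally show ?thesis by (simp add: sum_rank_one_form)
qed

text \<open>
  The inequality half of Sylvester's law of inertia. If there were more than \<open>p\<close> positive \<open>d m\<close>, some
  nonzero combination \<open>x\<close> of the corresponding \<open>u m\<close> would be orthogonal to \<open>f 0, \<dots>, f (p - 1)\<close>. The
  value of the Hermitian form at \<open>x\<close> would be positive by the left-hand side of the equation and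
  at most \<open>0\<close> by its right-hand side.
\<close>

lemma card_positive_le:
  fixes u f g :: "nat \<Rightarrow> nat \<Rightarrow> complex" and d :: "nat \<Rightarrow> real"
  assumes orth: "\<And>l m. l < n \<Longrightarrow> m < n \<Longrightarrow> (\<Sum>i<n. cnj (u l i) * u m i) = (if l = m then 1 else 0)"
    and eq: "\<And>i j. i < n \<Longrightarrow> j < n \<Longrightarrow> (\<Sum>m<n. complex_of_real (d m) * (u m i * cnj (u m j)))
      = (\<Sum>r<p. f r i * cnj (f r j)) - (\<Sum>r<q. g r i * cnj (g r j))"
  shows "card {m. m < n \<and> 0 < d m} \<le> p"
proof (rule ccontr)
  define S where "S = {m. m < n \<and> 0 < d m}"
  have S: "finite S" "S \<subseteq> {..<n}" by (auto simp: S_def)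
  assume "\<not> card {m. m < n \<and> 0 < d m} \<le> p"
  then have "p < card S" by (simp add: S_def)
  then obtain c where c0: "\<exists>m\<in>S. c m \<noteq> 0"
    and c: "\<forall>r<p. (\<Sum>m\<in>S. (\<Sum>i<n. cnj (f r i) * u m i) * c m) = 0"
    using underdetermined_system[OF S(1), of p "\<lambda>r m. \<Sum>i<n. cnj (f r i) * u m i"] by blast
  define x where "x i = (\<Sum>m\<in>S. c m * u m i)" for i
  have fx: "(\<Sum>i<n. cnj (f r i) * x i) = 0" if "r < p" for r
  proof -
    have "(\<Sum>i<n. cnj (f r i) * x i) = (\<Sum>m\<in>S. (\<Sum>i<n. cnj (f r i) * u m i) * c m)"
      unfolding x_def sum_distrib_left sum_distrib_right by (subst sum.swap) (simp add: mult_ac)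
    then show ?thesis using c that by simp
  qed
  have ux: "(\<Sum>i<n. cnj (u l i) * x i) = (if l \<in> S then c l else 0)" if l: "l < n" for l
  proof -
    have "(\<Sum>i<n. cnj (u l i) * x i) = (\<Sum>m\<in>S. c m * (\<Sum>i<n. cnj (u l i) * u m i))"
      unfolding x_def sum_distrib_left by (subst sum.swap) (simp add: mult_ac)
    also have "\<dots> = (\<Sum>m\<in>S. if m = l then c m else 0)"
      using orth[OF l] S(2) by (intro sum.cong) auto
    finally show ?thesis using S(1) by simp
  qed
  define Q where "Q = (\<Sum>i<n. \<Sum>j<n. cnj (x i) * (\<Sum>m<n. complex_of_real (d m) * (u m i * cnj (u m j))) * x j)"
  \<comment> \<open>the form at \<open>x\<close> is evaluated through the diagonalization and then through \<open>f\<close> and \<open>g\<close>\<close>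
  have Q1: "Q = complex_of_real (\<Sum>m<n. d m * (cmod (if m \<in> S then c m else 0))\<^sup>2)"
    unfolding Q_def hermitian_form_sum by (simp add: ux)
  have "Q = (\<Sum>i<n. \<Sum>j<n. cnj (x i) * (\<Sum>r<p. complex_of_real 1 * (f r i * cnj (f r j))) * x j)
      - (\<Sum>i<n. \<Sum>j<n. cnj (x i) * (\<Sum>r<q. complex_of_real 1 * (g r i * cnj (g r j))) * x j)"
    unfolding Q_def by (simp add: eq sum_subtractf[symmetric] algebra_simps)
  also have "\<dots> = complex_of_real (- (\<Sum>r<q. (cmod (\<Sum>i<n. cnj (g r i) * x i))\<^sup>2))"
    unfolding hermitian_form_sum by (simp add: fx)
  finally have "(\<Sum>m<n. d m * (cmod (if m \<in> S then c m else 0))\<^sup>2)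
      = - (\<Sum>r<q. (cmod (\<Sum>i<n. cnj (g r i) * x i))\<^sup>2)"
    unfolding Q1 of_real_eq_iff .
  also have "\<dots> \<le> 0" by (simp add: sum_nonneg)
  also obtain l where "l \<in> S" "c l \<noteq> 0" using c0 by blast
  then have "0 < (\<Sum>m<n. d m * (cmod (if m \<in> S then c m else 0))\<^sup>2)"
    by (intro sum_pos2[of _ l]) (auto simp: S_def)
  finally show False by simp
qed

text \<open>
  The negative index is the positive index of \<open>- A\<close>, whose decomposition exchanges \<open>f\<close> and \<open>g\<close>.
\<close>

lemma inertia_le_of_decomposition:
  assumes A: "A \<in> carrier_mat n n" and h: "hermitian_mat A"
    and eq: "\<And>i j. i < n \<Longrightarrow> j < n \<Longrightarrow>
      A $$ (i, j) = (\<Sum>r<p. f r i * cnj (f r j)) - (\<Sum>r<q. g r i * cnj (g r j))"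
  shows "num_pos_eigenvalues A \<le> p" "num_neg_eigenvalues A \<le> q"
proof -
  obtain U where U: "U \<in> carrier_mat n n" and U_props: "\<exists>d :: nat \<Rightarrow> real. mat_adjoint U * U = 1\<^sub>m n \<and>
      A = U * mat_diag n (\<lambda>i. complex_of_real (d i)) * mat_adjoint U \<and> (real_mat A \<longrightarrow> real_mat U)"
    using hermitian_diagonalization[OF A h] by (rule bexE)
  from U_props obtain d where UU: "mat_adjoint U * U = 1\<^sub>m n"
    and Ad: "A = U * mat_diag n (\<lambda>i. complex_of_real (d i)) * mat_adjoint U" by metis
  define u where "u m i = U $$ (i, m)" for m i
  have orth: "(\<Sum>i<n. cnj (u l i) * u m i) = (if l = m then 1 else 0)" if "l < n" "m < n" for l m
    using mat_adjoint_times_index[OF U U that] that unfolding UU by (simp add: u_def)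
  have sp: "(\<Sum>m<n. complex_of_real (d m) * (u m i * cnj (u m j)))
      = (\<Sum>r<p. f r i * cnj (f r j)) - (\<Sum>r<q. g r i * cnj (g r j))" if "i < n" "j < n" for i j
    unfolding u_def spectral_entries[OF U Ad that, symmetric] by (rule eq[OF that])
  have "card {m. m < n \<and> 0 < d m} \<le> p"
    by (rule card_positive_le[OF orth sp])
  then show "num_pos_eigenvalues A \<le> p"
    using eigenvalue_count_diagonalized[OF U UU Ad, of "\<lambda>x. 0 < x"] by (simp add: num_pos_eigenvalues_def)
  have sp': "(\<Sum>m<n. complex_of_real (- d m) * (u m i * cnj (u m j)))
      = (\<Sum>r<q. g r i * cnj (g r j)) - (\<Sum>r<p. f r i * cnj (f r j))" if "i < n" "j < n" for i j
    using sp[OF that] by (simp add: sum_negf algebra_simps)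
  have "card {m. m < n \<and> 0 < - d m} \<le> q"
    by (rule card_positive_le[OF orth sp'])
  then show "num_neg_eigenvalues A \<le> q"
    using eigenvalue_count_diagonalized[OF U UU Ad, of "\<lambda>x. x < 0"] by (simp add: num_neg_eigenvalues_def)
qed

section \<open>Generic rotations of a Gram decomposition\<close>

definition gram :: "nat \<Rightarrow> (nat \<Rightarrow> nat \<Rightarrow> complex) \<Rightarrow> nat \<Rightarrow> nat \<Rightarrow> complex" where
  "gram k w i j = (\<Sum>r<k. w r i * cnj (w r j))"

lemma gram_diagonal_nonzero:
  assumes "gram k w i j \<noteq> 0"
  shows "gram k w i i \<noteq> 0" "gram k w j j \<noteq> 0"
proof -
  obtain r where r: "r < k" "w r i \<noteq> 0" "w r j \<noteq> 0"
    using assms unfolding gram_def by (auto elim: sum.not_neutral_contains_not_neutral)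
  have diag: "gram k w l l = complex_of_real (\<Sum>r<k. (cmod (w r l))\<^sup>2)" for l
    by (simp add: gram_def complex_norm_square[symmetric])
  have "0 < (\<Sum>r<k. (cmod (w r l))\<^sup>2)" if "w r l \<noteq> 0" for l
    using r(1) that by (intro sum_pos2[of _ r]) auto
  from this[OF r(2)] this[OF r(3)] show "gram k w i i \<noteq> 0" "gram k w j j \<noteq> 0"
    unfolding diag of_real_eq_0_iff by simp_all
qed

text \<open>
  A unitary transformation of the vectors \<open>w 0\<close> and \<open>w s\<close>, with \<open>t\<close> the tangent of the angle up to a phase.
  Apart from the common normalizing factor the result is polynomial in \<open>t\<close> and \<open>cnj t\<close>, which is what
  the genericity arguments need.
\<close>

definition rotate :: "nat \<Rightarrow> complex \<Rightarrow> (nat \<Rightarrow> nat \<Rightarrow> complex) \<Rightarrow> nat \<Rightarrow> nat \<Rightarrow> complex" where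
  "rotate s t w =
     w(0 := \<lambda>i. (w 0 i + t * w s i) / complex_of_real (sqrt (1 + (cmod t)\<^sup>2)),
       s := \<lambda>i. (w s i - cnj t * w 0 i) / complex_of_real (sqrt (1 + (cmod t)\<^sup>2)))"

lemma sqrt_norm_facts:
  fixes t :: complex
  defines "c \<equiv> complex_of_real (sqrt (1 + (cmod t)\<^sup>2))"
  shows "c \<noteq> 0" "cnj c = c" "c * c = 1 + t * cnj t"
proof -
  have "sqrt (1 + (cmod t)\<^sup>2) > 0" by (simp add: add_pos_nonneg)
  then show "c \<noteq> 0" unfolding c_def by (metis less_irrefl of_real_eq_0_iff)
  show "cnj c = c" by (simp add: c_def)
  have "c * c = complex_of_real (sqrt (1 + (cmod t)\<^sup>2) * sqrt (1 + (cmod t)\<^sup>2))"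
    by (simp only: c_def of_real_mult)
  also have "\<dots> = complex_of_real (1 + (cmod t)\<^sup>2)"
    by (simp add: add_nonneg_nonneg)
  finally show "c * c = 1 + t * cnj t" by (simp add: complex_norm_square[symmetric])
qed

lemma gram_rotate:
  assumes "0 < s" "s < k"
  shows "gram k (rotate s t w) = gram k w"
proof (intro ext)
  fix i j
  define c where "c = complex_of_real (sqrt (1 + (cmod t)\<^sup>2))"
  note c = sqrt_norm_facts[of t, folded c_def]
  have split: "(\<Sum>r<k. f r) = f 0 + f s + (\<Sum>r\<in>{..<k} - {0, s}. f r)" for f :: "nat \<Rightarrow> complex"
    using assms by (subst sum.subset_diff[of "{0, s}"]) (auto simp: add.commute)
  have "rotate s t w 0 i * cnj (rotate s t w 0 j) + rotate s t w s i * cnj (rotate s t w s j)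
      = ((w 0 i + t * w s i) * cnj (w 0 j + t * w s j)
        + (w s i - cnj t * w 0 i) * cnj (w s j - cnj t * w 0 j)) / (c * c)"
    using assms(1) c(1) by (simp add: rotate_def c_def[symmetric] c(2) field_simps)
  also have "\<dots> = (w 0 i * cnj (w 0 j) + w s i * cnj (w s j)) * (1 + t * cnj t) / (c * c)"
    by (simp add: algebra_simps)
  also have "\<dots> = w 0 i * cnj (w 0 j) + w s i * cnj (w s j)"
    using c(1) unfolding c(3)[symmetric] by simp
  finally show "gram k (rotate s t w) i j = gram k w i j"
    unfolding gram_def split by (simp add: rotate_def)
qed

lemma rotate_real:
  assumes "\<And>r i. w r i \<in> \<real>" "t \<in> \<real>"
  shows "rotate s t w r i \<in> \<real>"
proof -
  have "cnj t = t" using assms(2) by (simp add: Reals_cnj_iff)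
  with assms show ?thesis
    by (simp add: rotate_def Reals_divide Reals_add Reals_mult Reals_diff)
qed

lemma real_avoiding_roots:
  fixes P :: "complex poly set"
  assumes "finite P" "0 \<notin> P"
  shows "\<exists>\<tau> :: real. \<forall>p\<in>P. poly p (complex_of_real \<tau>) \<noteq> 0"
proof -
  have "finite (complex_of_real -` {x. poly p x = 0})" if "p \<in> P" for p
    using poly_roots_finite[of p] that assms(2) by (intro finite_vimageI) (auto simp: inj_on_def)
  then have "finite (\<Union>p\<in>P. complex_of_real -` {x. poly p x = 0})"
    using assms(1) by blast
  then obtain \<tau> where "\<tau> \<notin> (\<Union>p\<in>P. complex_of_real -` {x. poly p x = 0})"
    using ex_new_if_finite[OF infinite_UNIV_char_0] by blast
  then show ?thesis by auto
qed

text \<open>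
  Here \<open>gram k w i i \<noteq> 0\<close> says that some \<open>w r i\<close> with \<open>r < k\<close> is nonzero. A rotation of \<open>w 0\<close> against this
  \<open>w r\<close> makes \<open>w 0 i\<close> nonzero; for all but finitely many parameters it leaves the entries that
  have already been treated nonzero.
\<close>

lemma exists_gram_first_nonzero:
  assumes "finite I"
  shows "\<exists>w'. gram k w' = gram k w \<and> ((\<forall>r i. w r i \<in> \<real>) \<longrightarrow> (\<forall>r i. w' r i \<in> \<real>)) \<and>
    (\<forall>i\<in>I. gram k w i i \<noteq> 0 \<longrightarrow> w' 0 i \<noteq> 0)"
  using assms
proof (induction I)
  case empty
  then show ?case by blast
next
  case (insert j I)
  then obtain v where v: "gram k v = gram k w" "(\<forall>r i. w r i \<in> \<real>) \<longrightarrow> (\<forall>r i. v r i \<in> \<real>)"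
    "\<forall>i\<in>I. gram k w i i \<noteq> 0 \<longrightarrow> v 0 i \<noteq> 0" by blast
  show ?case
  proof (cases "gram k w j j = 0 \<or> v 0 j \<noteq> 0")
    case True
    with v show ?thesis by blast
  next
    case False
    then have "gram k v j j \<noteq> 0" using v(1) by metis
    then obtain s where s: "s < k" "v s j \<noteq> 0"
      unfolding gram_def by (auto elim: sum.not_neutral_contains_not_neutral)
    with False have "0 < s" by (metis gr0I)
    define J where "J = insert j {i\<in>I. gram k w i i \<noteq> 0}"
    have J: "v 0 i \<noteq> 0 \<or> v s i \<noteq> 0" if "i \<in> J" for i using that v(3) s by (auto simp: J_def)
    have "finite ((\<lambda>i. [:v 0 i, v s i:]) ` J)" "0 \<notin> (\<lambda>i. [:v 0 i, v s i:]) ` J"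
      using insert.hyps J by (auto simp: J_def image_iff)
    then obtain \<tau> where \<tau>: "\<forall>p \<in> (\<lambda>i. [:v 0 i, v s i:]) ` J. poly p (complex_of_real \<tau>) \<noteq> 0"
      using real_avoiding_roots by blast
    define w' where "w' = rotate s (complex_of_real \<tau>) v"
    have nz: "w' 0 i \<noteq> 0" if "i \<in> J" for i
      using \<tau>[rule_format, OF imageI[OF that]] sqrt_norm_facts(1)[of "complex_of_real \<tau>"] \<open>0 < s\<close>
      by (simp add: w'_def rotate_def)
    show ?thesis
    proof (intro exI[of _ w'] conjI)
      show "gram k w' = gram k w" unfolding w'_def gram_rotate[OF \<open>0 < s\<close> s(1)] by (rule v(1))
      show "(\<forall>r i. w r i \<in> \<real>) \<longrightarrow> (\<forall>r i. w' r i \<in> \<real>)"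
        using v(2) rotate_real[of v "complex_of_real \<tau>" s] by (auto simp: w'_def)
      show "\<forall>i\<in>insert j I. gram k w i i \<noteq> 0 \<longrightarrow> w' 0 i \<noteq> 0"
        using nz by (auto simp: J_def)
    qed
  qed
qed

text \<open>
  The entries of \<open>w\<^sub>0 w\<^sub>0\<^sup>* - w\<^sub>1 w\<^sub>1\<^sup>*\<close>, by which \<open>M\<close> gets multiplied.
\<close>

definition split_form :: "(nat \<Rightarrow> nat \<Rightarrow> complex) \<Rightarrow> nat \<Rightarrow> nat \<Rightarrow> complex" where
  "split_form w i j = w 0 i * cnj (w 0 j) - w 1 i * cnj (w 1 j)"

text \<open>
  Along a fixed direction \<open>\<omega>\<close> on the unit circle, vanishing of an entry after the rotation is a quadratic
  equation in the real parameter \<open>\<tau>\<close>. Its constant coefficient is the entry before the rotation.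
\<close>

lemma split_form_rotate:
  fixes \<tau> :: real
  assumes "\<omega> * cnj \<omega> = 1"
  shows "split_form (rotate 1 (complex_of_real \<tau> * \<omega>) w) i j = 0 \<longleftrightarrow>
    poly [:split_form w i j, 2 * (\<omega> * (w 1 i * cnj (w 0 j)) + cnj \<omega> * (w 0 i * cnj (w 1 j))),
      - split_form w i j:] (complex_of_real \<tau>) = 0"
proof -
  define t where "t = complex_of_real \<tau> * \<omega>"
  define c where "c = complex_of_real (sqrt (1 + (cmod t)\<^sup>2))"
  note c = sqrt_norm_facts[of t, folded c_def]
  have tt: "t * cnj t = complex_of_real \<tau> * complex_of_real \<tau>"
    using assms by (simp add: t_def mult_ac)
  have "split_form (rotate 1 t w) i j * (c * c)
      = (w 0 i + t * w 1 i) * cnj (w 0 j + t * w 1 j)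
        - (w 1 i - cnj t * w 0 i) * cnj (w 1 j - cnj t * w 0 j)"
    using c(1) by (simp add: split_form_def rotate_def c_def[symmetric] c(2) field_simps)
  also have "\<dots> = (1 - t * cnj t) * split_form w i j
      + 2 * (t * (w 1 i * cnj (w 0 j)) + cnj t * (w 0 i * cnj (w 1 j)))"
    by (simp add: split_form_def algebra_simps)
  also have "\<dots> = poly [:split_form w i j,
      2 * (\<omega> * (w 1 i * cnj (w 0 j)) + cnj \<omega> * (w 0 i * cnj (w 1 j))),
      - split_form w i j:] (complex_of_real \<tau>)"
    unfolding tt by (simp add: t_def algebra_simps)
  finally show ?thesis using c(1) unfolding t_def by (metis mult_eq_0_iff)
qed

text \<open>
  If an entry vanishes although \<open>w 0\<close> does not vanish at \<open>i\<close> and \<open>j\<close>, the linear coefficient in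
  \<open>split_form_rotate\<close> is nonzero for \<open>\<omega> = 1\<close> or for \<open>\<omega> = \<i>\<close>. With \<open>p\<close>, \<open>q\<close> and \<open>a\<close> as in the proof,
  both \<open>w 0 i * cnj (w 0 j)\<close> and \<open>w 1 i * cnj (w 1 j)\<close> equal \<open>a\<close>, so rank one gives
  \<open>p q = a\<^sup>2 \<noteq> 0\<close>. Hence \<open>p + q\<close> and \<open>p - q\<close> are not both \<open>0\<close>. If \<open>p + q = 0\<close>, the failure of \<open>\<omega> = 1\<close>,
  then \<open>- p\<^sup>2 = a\<^sup>2\<close>, which nonzero real numbers do not satisfy.
\<close>

lemma exists_rotation_direction:
  assumes "w 0 i \<noteq> 0" "w 0 j \<noteq> 0" "split_form w i j = 0"
  shows "\<exists>\<omega>. \<omega> * cnj \<omega> = 1 \<and> ((\<forall>r i. w r i \<in> \<real>) \<longrightarrow> \<omega> \<in> \<real>) \<and>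
    \<omega> * (w 1 i * cnj (w 0 j)) + cnj \<omega> * (w 0 i * cnj (w 1 j)) \<noteq> 0"
proof -
  define p where "p = w 1 i * cnj (w 0 j)"
  define q where "q = w 0 i * cnj (w 1 j)"
  define a where "a = w 0 i * cnj (w 0 j)"
  have a: "a \<noteq> 0" using assms(1,2) by (simp add: a_def)
  have "p * q = a * (w 1 i * cnj (w 1 j))" by (simp add: p_def q_def a_def mult_ac)
  also have "w 1 i * cnj (w 1 j) = a" using assms(3) by (simp add: split_form_def a_def)
  finally have pq: "p * q = a * a" .
  show ?thesis
  proof (cases "p + q = 0")
    case False
    then show ?thesis by (intro exI[of _ 1]) (simp add: p_def q_def)
  next
    case True
    then have q: "q = - p" by (metis add.inverse_unique)
    have "p \<noteq> 0" using pq a by auto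
    have "\<not> (\<forall>r i. w r i \<in> \<real>)"
    proof
      assume r: "\<forall>r i. w r i \<in> \<real>"
      then have "p \<in> \<real>" "a \<in> \<real>" by (auto simp: p_def a_def Reals_cnj_iff)
      then obtain x y where "p = complex_of_real x" "a = complex_of_real y" by (metis Reals_cases)
      with pq q have "complex_of_real (- (x * x)) = complex_of_real (y * y)" by simp
      then have "- (x * x) = y * y" by (simp only: of_real_eq_iff)
      then have "x * x + y * y = 0" by linarith
      then have "y = 0" unfolding sum_squares_eq_zero_iff by simp
      with a \<open>a = complex_of_real y\<close> show False by simp
    qed
    moreover have "\<i> * p + cnj \<i> * q \<noteq> 0" using \<open>p \<noteq> 0\<close> q by simp
    ultimately show ?thesis by (intro exI[of _ \<i>]) (simp add: p_def q_def)
  qed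
qed

text \<open>
  Positions are added to \<open>F\<close> one at a time. The rotation that repairs the new position must avoid the roots of
  finitely many polynomials: linear ones that keep \<open>w 0\<close> nonzero on \<open>I\<close>, which the next step relies on,
  and quadratic ones for the positions treated so far and for the new one.
\<close>

lemma exists_gram_split_form_nonzero:
  assumes "1 < k" "finite I" and w0: "\<forall>i\<in>I. w 0 i \<noteq> 0" and "finite F" "F \<subseteq> I \<times> I"
  shows "\<exists>w'. gram k w' = gram k w \<and> ((\<forall>r i. w r i \<in> \<real>) \<longrightarrow> (\<forall>r i. w' r i \<in> \<real>)) \<and>
    (\<forall>i\<in>I. w' 0 i \<noteq> 0) \<and> (\<forall>(i, j)\<in>F. split_form w' i j \<noteq> 0)"
  using assms(4,5)
proof (induction F)
  case empty
  with w0 show ?case by blast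
next
  case (insert e F)
  then obtain v where v: "gram k v = gram k w" "(\<forall>r i. w r i \<in> \<real>) \<longrightarrow> (\<forall>r i. v r i \<in> \<real>)"
    "\<forall>i\<in>I. v 0 i \<noteq> 0" "\<forall>(i, j)\<in>F. split_form v i j \<noteq> 0" by blast
  obtain x y where e: "e = (x, y)" "x \<in> I" "y \<in> I" using insert.prems by auto
  show ?case
  proof (cases "split_form v x y = 0")
    case False
    with v e show ?thesis by blast
  next
    case True
    obtain \<omega> where \<omega>: "\<omega> * cnj \<omega> = 1" "(\<forall>r i. v r i \<in> \<real>) \<longrightarrow> \<omega> \<in> \<real>"
      "\<omega> * (v 1 x * cnj (v 0 y)) + cnj \<omega> * (v 0 x * cnj (v 1 y)) \<noteq> 0"
      using exists_rotation_direction[of v x y] v(3) e True by blast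
    define A where "A = (\<lambda>i. [:v 0 i, \<omega> * v 1 i:]) ` I"
    define B where "B = (\<lambda>(i, j). [:split_form v i j,
      2 * (\<omega> * (v 1 i * cnj (v 0 j)) + cnj \<omega> * (v 0 i * cnj (v 1 j))),
      - split_form v i j:]) ` insert e F"
    have fin: "finite (A \<union> B)" using assms(2) insert.hyps by (simp add: A_def B_def)
    have \<omega>3: "2 * (\<omega> * (v 1 x * cnj (v 0 y)) + cnj \<omega> * (v 0 x * cnj (v 1 y))) \<noteq> 0"
      using \<omega>(3) by (metis mult_eq_0_iff zero_neq_numeral)
    have "0 \<notin> A" using v(3) by (auto simp: A_def)
    moreover have "0 \<notin> B" using v(4) \<omega>3 e(1) by (auto simp: B_def)
    ultimately obtain \<tau> where \<tau>: "\<And>p. p \<in> A \<union> B \<Longrightarrow> poly p (complex_of_real \<tau>) \<noteq> 0"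
      using real_avoiding_roots[OF fin] by auto
    let ?t = "complex_of_real \<tau> * \<omega>"
    show ?thesis
    proof (intro exI[of _ "rotate 1 ?t v"] conjI)
      show "gram k (rotate 1 ?t v) = gram k w"
        using gram_rotate[of 1 k ?t v] assms(1) v(1) by simp
      show "(\<forall>r i. w r i \<in> \<real>) \<longrightarrow> (\<forall>r i. rotate 1 ?t v r i \<in> \<real>)"
        using v(2) \<omega>(2) rotate_real[of v ?t 1] by auto
      show "\<forall>i\<in>I. rotate 1 ?t v 0 i \<noteq> 0"
      proof
        fix i assume "i \<in> I"
        then have "poly [:v 0 i, \<omega> * v 1 i:] (complex_of_real \<tau>) \<noteq> 0"
          by (intro \<tau>) (auto simp: A_def)
        then show "rotate 1 ?t v 0 i \<noteq> 0"
          using sqrt_norm_facts(1)[of ?t] by (simp add: rotate_def mult_ac)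
      qed
      show "\<forall>(i, j)\<in>insert e F. split_form (rotate 1 ?t v) i j \<noteq> 0"
      proof (clarify)
        fix i j assume "(i, j) \<in> insert e F" and z: "split_form (rotate 1 ?t v) i j = 0"
        then have "[:split_form v i j,
            2 * (\<omega> * (v 1 i * cnj (v 0 j)) + cnj \<omega> * (v 0 i * cnj (v 1 j))),
            - split_form v i j:] \<in> A \<union> B"
          by (force simp: B_def)
        from \<tau>[OF this] z show False unfolding split_form_rotate[OF \<omega>(1)] by (rule notE)
      qed
    qed
  qed
qed

section \<open>Lowering both inertia indices\<close>

text \<open>
  Scale the eigenvectors for the positive eigenvalues by the square roots of these eigenvalues. The entries
  outside the relevant index range are set to \<open>0\<close>, so that realness can be stated for all indices.
\<close>

lemma gram_decomposition:
  assumes M: "M \<in> carrier_mat n n" and h: "hermitian_mat M" and inertia: "partial_inertia M = (k, 0)"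
  shows "\<exists>w. (\<forall>i<n. \<forall>j<n. M $$ (i, j) = gram k w i j) \<and> (real_mat M \<longrightarrow> (\<forall>r i. w r i \<in> \<real>))"
proof -
  obtain U where U: "U \<in> carrier_mat n n" and U_props: "\<exists>d :: nat \<Rightarrow> real. mat_adjoint U * U = 1\<^sub>m n \<and>
      M = U * mat_diag n (\<lambda>i. complex_of_real (d i)) * mat_adjoint U \<and> (real_mat M \<longrightarrow> real_mat U)"
    using hermitian_diagonalization[OF M h] by (rule bexE)
  from U_props obtain d where UU: "mat_adjoint U * U = 1\<^sub>m n"
    and Md: "M = U * mat_diag n (\<lambda>i. complex_of_real (d i)) * mat_adjoint U"
    and Ur: "real_mat M \<longrightarrow> real_mat U" by metis
  define S where "S = {m. m < n \<and> 0 < d m}"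
  have S: "finite S" "S \<subseteq> {..<n}" by (auto simp: S_def)
  have "card S = k" "card {m. m < n \<and> d m < 0} = 0"
    using inertia eigenvalue_count_diagonalized[OF U UU Md, of "\<lambda>x. 0 < x"]
      eigenvalue_count_diagonalized[OF U UU Md, of "\<lambda>x. x < 0"]
    by (auto simp: partial_inertia_def num_pos_eigenvalues_def num_neg_eigenvalues_def S_def)
  then have nonneg: "d m = 0" if "m < n" "m \<notin> S" for m
    using that by (force simp: S_def card_eq_0_iff)
  obtain h where h: "bij_betw h {..<k} S"
    using ex_bij_betw_nat_finite[OF S(1)] \<open>card S = k\<close> unfolding lessThan_atLeast0 by blast
  define w where "w r i = (if r < k \<and> i < n then complex_of_real (sqrt (d (h r))) * U $$ (i, h r) else 0)" for r i
  have "M $$ (i, j) = gram k w i j" if ij: "i < n" "j < n" for i j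
  proof -
    have "M $$ (i, j) = (\<Sum>m<n. complex_of_real (d m) * (U $$ (i, m) * cnj (U $$ (j, m))))"
      by (rule spectral_entries[OF U Md ij])
    also have "\<dots> = (\<Sum>m\<in>S. complex_of_real (d m) * (U $$ (i, m) * cnj (U $$ (j, m))))"
      using S nonneg by (intro sum.mono_neutral_right) auto
    also have "\<dots> = (\<Sum>r<k. complex_of_real (d (h r)) * (U $$ (i, h r) * cnj (U $$ (j, h r))))"
      by (rule sum.reindex_bij_betw[OF h, symmetric])
    also have "\<dots> = gram k w i j"
      unfolding gram_def
    proof (intro sum.cong refl)
      fix r assume r: "r \<in> {..<k}"
      then have "h r \<in> S" using h by (auto simp: bij_betw_def)
      then have "complex_of_real (d (h r)) = complex_of_real (sqrt (d (h r))) * complex_of_real (sqrt (d (h r)))"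
        unfolding of_real_mult[symmetric] by (simp add: S_def)
      then show "complex_of_real (d (h r)) * (U $$ (i, h r) * cnj (U $$ (j, h r))) = w r i * cnj (w r j)"
        using r ij by (simp add: w_def mult_ac)
    qed
    finally show ?thesis .
  qed
  moreover have "w r i \<in> \<real>" if "real_mat M" for r i
  proof (cases "r < k \<and> i < n")
    case True
    then have "h r < n" using h S(2) by (auto simp: bij_betw_def)
    then show ?thesis
      using that Ur True unfolding real_mat_iff[OF U] by (auto simp: w_def intro!: Reals_mult)
  next
    case False
    then have "w r i = 0" unfolding w_def by (rule if_not_P)
    then show ?thesis by simp
  qed
  ultimately show ?thesis by blast
qed

text \<open>
  Each sum on the right is \<open>[w\<^sub>s w\<^sub>s] + [w\<^sub>2 w\<^sub>s] + \<dots> + [w\<^sub>k\<^sub>-\<^sub>1 w\<^sub>s]\<close> for \<open>s = 0\<close> and \<open>s = 1\<close>. The index \<open>r = 0\<close>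
  stands for the square and \<open>r > 0\<close> for the product with \<open>w\<^sub>r\<^sub>+\<^sub>1\<close>. Of \<open>k\<close> products with \<open>w\<^sub>s\<close> only
  \<open>k - 1\<close> remain, because \<open>[w\<^sub>0 w\<^sub>1]\<close> occurs with both signs.
\<close>

lemma gram_times_split_form:
  assumes "1 < k"
  shows "gram k w i j * split_form w i j =
    (\<Sum>r<k - 1. (if r = 0 then w 0 i * w 0 i else w (Suc r) i * w 0 i)
      * cnj (if r = 0 then w 0 j * w 0 j else w (Suc r) j * w 0 j)) -
    (\<Sum>r<k - 1. (if r = 0 then w 1 i * w 1 i else w (Suc r) i * w 1 i)
      * cnj (if r = 0 then w 1 j * w 1 j else w (Suc r) j * w 1 j))"
proof -
  obtain l where k: "k = Suc (Suc l)" using less_imp_Suc_add[OF assms] by auto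
  define R where "R = (\<Sum>r<l. w (Suc (Suc r)) i * cnj (w (Suc (Suc r)) j))"
  have "gram k w i j = w 0 i * cnj (w 0 j) + w 1 i * cnj (w 1 j) + R"
    by (simp add: gram_def k R_def sum.lessThan_Suc_shift del: sum.lessThan_Suc)
  moreover have "(\<Sum>r<k - 1. (if r = 0 then w s i * w s i else w (Suc r) i * w s i)
      * cnj (if r = 0 then w s j * w s j else w (Suc r) j * w s j))
    = (w s i * cnj (w s j)) * (w s i * cnj (w s j)) + (w s i * cnj (w s j)) * R" for s
    by (simp add: k R_def sum.lessThan_Suc_shift sum_distrib_left mult_ac del: sum.lessThan_Suc)
  ultimately show ?thesis by (simp only:) (simp add: split_form_def algebra_simps)
qed

theorem theorem7p1:
  fixes G :: "nat pair_pre_digraph" and n k :: nat and M :: "complex mat"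
  assumes "pair_graph G" and "pverts G = {..<n}"
    and "M \<in> hermitian_mats_of_graph G"
    and "partial_inertia M = (k, 0)" and "k > 1"
  shows "\<exists>M' \<in> hermitian_mats_of_graph G. \<exists>r s.
           partial_inertia M' = (r, s) \<and> r < k \<and> s < k \<and> (real_mat M \<longrightarrow> real_mat M')"
proof -
  have M: "M \<in> carrier_mat n n" and h: "hermitian_mat M"
    and pattern: "\<And>i j. i < n \<Longrightarrow> j < n \<Longrightarrow> i \<noteq> j \<Longrightarrow> M $$ (i, j) \<noteq> 0 \<longleftrightarrow> (i, j) \<in> parcs G"
    using assms(2,3) by (auto simp: hermitian_mats_of_graph_def)
  obtain u where u: "\<forall>i<n. \<forall>j<n. M $$ (i, j) = gram k u i j"
    "real_mat M \<longrightarrow> (\<forall>r i. u r i \<in> \<real>)"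
    using gram_decomposition[OF M h assms(4)] by blast
  obtain v where v: "gram k v = gram k u" "(\<forall>r i. u r i \<in> \<real>) \<longrightarrow> (\<forall>r i. v r i \<in> \<real>)"
    "\<forall>i\<in>{..<n}. gram k u i i \<noteq> 0 \<longrightarrow> v 0 i \<noteq> 0"
    using exists_gram_first_nonzero[of "{..<n}" k u] by blast
  \<comment> \<open>every nonzero position of \<open>M\<close>, diagonal ones included, lies in \<open>I \<times> I\<close>\<close>
  define I where "I = {i. i < n \<and> v 0 i \<noteq> 0}"
  define F where "F = {(i, j) \<in> I \<times> I. M $$ (i, j) \<noteq> 0}"
  have fin: "finite I" "F \<subseteq> I \<times> I" by (auto simp: I_def F_def)
  then have "finite F" by (meson finite_SigmaI finite_subset)
  obtain w where w: "gram k w = gram k v" "(\<forall>r i. v r i \<in> \<real>) \<longrightarrow> (\<forall>r i. w r i \<in> \<real>)"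
    "\<forall>(i, j)\<in>F. split_form w i j \<noteq> 0"
    using exists_gram_split_form_nonzero[OF assms(5) fin(1) _ \<open>finite F\<close> fin(2), of v]
    by (auto simp: I_def)
  have Mw: "M $$ (i, j) = gram k w i j" if "i < n" "j < n" for i j
    using u(1) that v(1) w(1) by simp
  have wr: "w r i \<in> \<real>" if "real_mat M" for r i using u(2) v(2) w(2) that by blast
  have nz: "split_form w i j \<noteq> 0" if ij: "i < n" "j < n" and "M $$ (i, j) \<noteq> 0" for i j
  proof -
    have "gram k u i j \<noteq> 0" using u(1) that by metis
    then have "gram k u i i \<noteq> 0 \<and> gram k u j j \<noteq> 0" using gram_diagonal_nonzero by blast
    then have "(i, j) \<in> F" using v(3) that by (auto simp: F_def I_def)
    then show ?thesis using w(3) by blast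
  qed
  define M' where "M' = mat n n (\<lambda>(i, j). M $$ (i, j) * split_form w i j)"
  have M': "M' \<in> carrier_mat n n" by (simp add: M'_def)
  have h': "hermitian_mat M'"
    unfolding hermitian_mat_iff[OF M']
  proof (intro allI impI)
    fix i j assume "i < n" "j < n"
    moreover from this have "M $$ (i, j) = cnj (M $$ (j, i))" using h hermitian_mat_iff[OF M] by blast
    ultimately show "M' $$ (i, j) = cnj (M' $$ (j, i))"
      by (simp add: M'_def split_form_def mult.commute)
  qed
  have "M' $$ (i, j) \<noteq> 0 \<longleftrightarrow> M $$ (i, j) \<noteq> 0" if "i < n" "j < n" for i j
    using nz that by (auto simp: M'_def)
  then have "M' \<in> hermitian_mats_of_graph G"
    using M' h' pattern by (simp add: hermitian_mats_of_graph_def assms(2))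
  moreover have "real_mat M'" if "real_mat M"
    using that wr[OF that] unfolding real_mat_iff[OF M] real_mat_iff[OF M']
    by (auto simp: M'_def split_form_def Reals_cnj_iff)
  moreover have "num_pos_eigenvalues M' \<le> k - 1" "num_neg_eigenvalues M' \<le> k - 1"
  proof -
    define f where "f s r i = (if r = 0 then w s i * w s i else w (Suc r) i * w s i)" for s r i
    have dec: "M' $$ (i, j)
        = (\<Sum>r<k - 1. f 0 r i * cnj (f 0 r j)) - (\<Sum>r<k - 1. f 1 r i * cnj (f 1 r j))"
      if "i < n" "j < n" for i j
    proof -
      have "M' $$ (i, j) = gram k w i j * split_form w i j" using that by (simp add: M'_def Mw)
      then show ?thesis unfolding f_def gram_times_split_form[OF assms(5)] .
    qed
    show "num_pos_eigenvalues M' \<le> k - 1"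
      by (rule inertia_le_of_decomposition(1)[OF M' h' dec])
    show "num_neg_eigenvalues M' \<le> k - 1"
      by (rule inertia_le_of_decomposition(2)[OF M' h' dec])
  qed
  ultimately show ?thesis
    using assms(5) by (intro bexI[of _ M']) (auto simp: partial_inertia_def)
qed

end
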